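(* Let $\mathcal X\subset\mathbb R^m$ be compact, $A\in\mathbb R^{d\times m}$, $b\in\mathbb R^d$, $\alpha>0$, $\beta>0$, and let $g:\mathbb R^d\to\mathbb R$ be convex and differentiable with globally $\frac1\beta$-Lipschitz gradient, with Fenchel conjugate $g^*$. For every Borel probability measure $\mu$ on $\mathcal X$, the dual MEM problem $$\min_{z\in\mathbb R^d}\ \alpha g^*(-z/\alpha)-\langle b,z\rangle+\log\int_{\mathcal X}\exp\langle A^\top z,x\rangle\,d\mu(x)$$ has exactly the same solution(s) as the expected risk minimization problem $$\min_{z\in\mathbb R^d}\ \mathbb E_{X\sim\mu}[\ell(X,z)],\qquad \ell(x,z):=\exp\big(\alpha g^*(-z/\alpha)-\langle b,z\rangle+\langle A^\top z,x\rangle\big).$$ In particular, for $X_1,\dots,X_n\in\mathcal X$ and $\hat\mu_n=\frac1n\sum_{i=1}^n\delta_{X_i}$, the dual MEM problem with prior $\hat\mu_n$ has the same solution(s) as $\min_{z\in\mathbb R^d}\frac1n\sum_{i=1}^n\ell(X_i,z)$.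
   Context: The conjugate $g^*$ may take the value $+\infty$; the convention $e^{+\infty}=+\infty$ is used. *)

theory Defs
  imports "HOL-Probability.Probability"
begin

definition fenchel_conjugate :: "('a::real_inner \<Rightarrow> real) \<Rightarrow> 'a \<Rightarrow> ereal" where
  "fenchel_conjugate g z = (SUP y. ereal (z \<bullet> y - g y))"

definition exp_ext :: "ereal \<Rightarrow> ennreal" where
  "exp_ext t = (case t of ereal r \<Rightarrow> ennreal (exp r) | PInfty \<Rightarrow> \<infinity> | MInfty \<Rightarrow> 0)"

lemma exp_ext_simps [simp]:
  "exp_ext (ereal r) = ennreal (exp r)" "exp_ext \<infinity> = \<infinity>" "exp_ext (-\<infinity>) = 0"
  unfolding exp_ext_def by (simp_all flip: infinity_ereal_def uminus_ereal.simps)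

text \<open>The space of the measure is \<open>S\<close> itself, equipped with the Borel sigma-algebra of the
  subspace topology.\<close>

definition borel_prob_on :: "'a::topological_space set \<Rightarrow> 'a measure \<Rightarrow> bool" where
  "borel_prob_on S M \<longleftrightarrow> prob_space M \<and> sets M = sets (restrict_space borel S)"

lemma space_borel_prob_on: "borel_prob_on S M \<Longrightarrow> space M = S"
  unfolding borel_prob_on_def by (metis sets_eq_imp_space_eq space_borel space_restrict_space2
      sets.top space_restrict_space inf_top_right)

text \<open>The integrand is positive, and bounded when \<open>space \<mu>\<close> is compact, so for a probability
  measure the real logarithm is applied to a genuine positive real integral.\<close>

definition dual_mem_objective ::
  "real^'m^'d \<Rightarrow> real^'d \<Rightarrow> real \<Rightarrow> (real^'d \<Rightarrow> real) \<Rightarrow> (real^'m) measure \<Rightarrow> real^'d \<Rightarrow> ereal" where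
  "dual_mem_objective A b \<alpha> g \<mu> z =
     ereal \<alpha> * fenchel_conjugate g (- z /\<^sub>R \<alpha>) - ereal (b \<bullet> z)
       + ereal (ln (\<integral>x. exp ((transpose A *v z) \<bullet> x) \<partial>\<mu>))"

definition mem_loss ::
  "real^'m^'d \<Rightarrow> real^'d \<Rightarrow> real \<Rightarrow> (real^'d \<Rightarrow> real) \<Rightarrow> real^'m \<Rightarrow> real^'d \<Rightarrow> ennreal" where
  "mem_loss A b \<alpha> g x z =
     exp_ext (ereal \<alpha> * fenchel_conjugate g (- z /\<^sub>R \<alpha>) - ereal (b \<bullet> z)
       + ereal ((transpose A *v z) \<bullet> x))"

definition solutions :: "('a \<Rightarrow> 'b::linorder) \<Rightarrow> 'a set" where
  "solutions f = {z. is_arg_min f (\<lambda>_. True) z}"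

definition empirical_measure ::
  "'a::topological_space set \<Rightarrow> nat \<Rightarrow> (nat \<Rightarrow> 'a) \<Rightarrow> 'a measure" where
  "empirical_measure S n X = measure_of S (sets (restrict_space borel S))
     (\<lambda>B. ennreal (1 / real n) * (\<Sum>i=1..n. emeasure (return (restrict_space borel S) (X i)) B))"

lemma space_empirical_measure [simp]: "space (empirical_measure S n X) = S"
  and sets_empirical_measure [simp]:
    "sets (empirical_measure S n X) = sets (restrict_space borel S)"
proof -
  have S: "space (restrict_space borel S) = S"
    by (simp add: space_restrict_space)
  show "space (empirical_measure S n X) = S"
    unfolding empirical_measure_def
    by (rule space_measure_of) (use sets.space_closed[of "restrict_space borel S"] S in simp)
  show "sets (empirical_measure S n X) = sets (restrict_space borel S)"
    unfolding empirical_measure_def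
    using sets.sigma_sets_eq[of "restrict_space borel S"] sets.space_closed[of "restrict_space borel S"] S
    by simp
qed

text \<open>Since \<^term>\<open>measure_of\<close> yields the zero measure for set functions that are not countably
  additive, it has to be checked that the empirical measure has the intended values.\<close>

lemma emeasure_empirical_measure:
  assumes "B \<in> sets (restrict_space borel S)"
  shows "emeasure (empirical_measure S n X) B =
    ennreal (1 / real n) * (\<Sum>i=1..n. indicator B (X i))"
proof -
  let ?N = "restrict_space borel S"
  let ?f = "\<lambda>B. ennreal (1 / real n) * (\<Sum>i=1..n. emeasure (return ?N (X i)) B)"
  have "emeasure (empirical_measure S n X) B = ?f B"
  proof (rule emeasure_measure_of[OF empirical_measure_def])
    show "sets ?N \<subseteq> Pow S"
      using sets.space_closed[of ?N] by (simp add: space_restrict_space)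
    show "B \<in> sets (empirical_measure S n X)" using assms by simp
    show "positive (sets (empirical_measure S n X)) ?f" by (simp add: positive_def)
    show "countably_additive (sets (empirical_measure S n X)) ?f"
    proof (rule countably_additiveI)
      fix F :: "nat \<Rightarrow> 'a set"
      assume F: "range F \<subseteq> sets (empirical_measure S n X)" "disjoint_family F"
      have "(\<Sum>k. emeasure (return ?N (X i)) (F k)) = emeasure (return ?N (X i)) (\<Union>k. F k)" for i
        by (rule suminf_emeasure) (use F in auto)
      then show "(\<Sum>k. ?f (F k)) = ?f (\<Union>k. F k)"
        by (simp add: suminf_sum)
    qed
  qed
  then show ?thesis using assms by simp
qed

lemma borel_prob_on_empirical_measure:
  assumes "n \<ge> 1" "\<And>i. i \<in> {1..n} \<Longrightarrow> X i \<in> S"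
  shows "borel_prob_on S (empirical_measure S n X)"
proof -
  have "S \<in> sets (restrict_space borel S)"
    using sets.top[of "restrict_space borel S"] by (simp add: space_restrict_space)
  moreover have "(\<Sum>i=1..n. indicator S (X i)) = (of_nat n :: ennreal)"
    using assms(2) by simp
  moreover have "ennreal (1 / real n) * of_nat n = 1"
    using assms(1) by (simp add: ennreal_of_nat_eq_real_of_nat flip: ennreal_mult')
  ultimately have "emeasure (empirical_measure S n X) S = 1"
    by (simp add: emeasure_empirical_measure)
  then show ?thesis
    unfolding borel_prob_on_def by (auto intro: prob_spaceI)
qed

end

theory Submission
  imports Defs
begin

text \<open>The dual objective is the logarithm of the expected risk. In the loss, the factor
  \<open>c z = \<alpha> g*(-z/\<alpha>) - \<langle>b, z\<rangle>\<close> of the exponent does not depend on \<open>x\<close>, so \<open>exp (c z)\<close> comes out of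
  the integral:
  \<open>\<integral> exp (c z + \<langle>A\<^sup>T z, x\<rangle>) d\<mu>(x) = exp (c z) * I z = exp (c z + log (I z))\<close>, where
  \<open>I z = \<integral> exp \<langle>A\<^sup>T z, x\<rangle> d\<mu>(x)\<close>. Compactness of the support makes \<open>I z\<close> finite, and \<open>\<mu>\<close> being a
  probability measure makes it positive, so that \<open>exp (log (I z)) = I z\<close>
  (\<open>nn_integral_mem_loss\<close>). The exponential from the extended reals onto \<open>[0, \<infinity>]\<close> is strictly
  increasing, also at the infinite values (\<open>strict_mono_exp_ext\<close>), and composing an objective
  with a strictly increasing function leaves its minimizers unchanged (\<open>solutions_strict_mono\<close>).
  The empirical problem is the special case \<open>\<mu> = (1/n) \<Sum> \<delta>\<^bsub>X i\<^esub>\<close>, whose integral is the sample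
  average (\<open>nn_integral_empirical_measure\<close>).\<close>

lemma solutions_strict_mono:
  fixes h :: "'b::linorder \<Rightarrow> 'c::linorder"
  assumes "strict_mono h"
  shows "solutions (\<lambda>z. h (f z)) = solutions f"
  using assms by (simp add: solutions_def is_arg_min_def strict_mono_less)

lemma strict_mono_exp_ext: "strict_mono exp_ext"
proof (rule strict_monoI)
  fix s t :: ereal
  assume "s < t"
  then show "exp_ext s < exp_ext t"
    by (cases s; cases t) (auto simp: ennreal_lessI)
qed

text \<open>The functional equation survives for infinite \<open>c\<close> because \<open>exp r\<close> is neither zero nor
  infinite, so the product is never of the form \<open>\<infinity> * 0\<close>.\<close>

lemma exp_ext_add_ereal: "exp_ext (c + ereal r) = exp_ext c * ennreal (exp r)"
  by (cases c) (simp_all add: exp_add ennreal_mult ennreal_top_mult)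

lemma measurable_borel_prob_on:
  assumes "borel_prob_on S \<mu>" "f \<in> borel_measurable borel"
  shows "f \<in> borel_measurable \<mu>"
  using assms measurable_cong_sets[of \<mu> "restrict_space borel S" borel borel]
  by (auto simp: borel_prob_on_def intro: measurable_restrict_space1)

lemma exp_inner_integral:
  fixes S :: "'a::euclidean_space set"
  assumes "compact S" "borel_prob_on S \<mu>"
  shows integrable_exp_inner: "integrable \<mu> (\<lambda>x. exp (u \<bullet> x))"
    and integral_exp_inner_pos: "(\<integral>x. exp (u \<bullet> x) \<partial>\<mu>) > 0"
proof -
  interpret prob_space \<mu> using assms(2) by (simp add: borel_prob_on_def)
  obtain B where B: "\<And>x. x \<in> S \<Longrightarrow> norm x \<le> B"
    using compact_imp_bounded[OF assms(1)] by (auto simp: bounded_iff)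
  have bound: "\<bar>u \<bullet> x\<bar> \<le> norm u * B" if "x \<in> space \<mu>" for x
  proof -
    have "x \<in> S" using that space_borel_prob_on[OF assms(2)] by simp
    then show ?thesis
      using Cauchy_Schwarz_ineq2[of u x] mult_left_mono[OF B, of x "norm u"] by simp
  qed
  show int: "integrable \<mu> (\<lambda>x. exp (u \<bullet> x))"
  proof (rule integrable_const_bound)
    show "AE x in \<mu>. norm (exp (u \<bullet> x)) \<le> exp (norm u * B)"
      using bound by (intro AE_I2) (simp add: abs_le_iff)
    show "(\<lambda>x. exp (u \<bullet> x)) \<in> borel_measurable \<mu>"
      by (rule measurable_borel_prob_on[OF assms(2)]) measurable
  qed
  have "exp (- (norm u * B)) \<le> (\<integral>x. exp (u \<bullet> x) \<partial>\<mu>)"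
  proof (rule integral_ge_const[OF int], rule AE_I2)
    fix x assume "x \<in> space \<mu>"
    then show "exp (- (norm u * B)) \<le> exp (u \<bullet> x)"
      using bound[of x] by (simp add: abs_le_iff)
  qed
  then show "(\<integral>x. exp (u \<bullet> x) \<partial>\<mu>) > 0"
    using less_le_trans[OF exp_gt_zero] by blast
qed

lemma nn_integral_mem_loss:
  assumes "compact S" "borel_prob_on S \<mu>"
  shows "(\<integral>\<^sup>+x. mem_loss A b \<alpha> g x z \<partial>\<mu>) = exp_ext (dual_mem_objective A b \<alpha> g \<mu> z)"
proof -
  define c where "c = ereal \<alpha> * fenchel_conjugate g (- z /\<^sub>R \<alpha>) - ereal (b \<bullet> z)"
  define u where "u = transpose A *v z"
  have "(\<integral>\<^sup>+x. mem_loss A b \<alpha> g x z \<partial>\<mu>) = (\<integral>\<^sup>+x. exp_ext c * ennreal (exp (u \<bullet> x)) \<partial>\<mu>)"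
    by (simp add: mem_loss_def c_def u_def exp_ext_add_ereal)
  also have "\<dots> = exp_ext c * (\<integral>\<^sup>+x. ennreal (exp (u \<bullet> x)) \<partial>\<mu>)"
    by (intro nn_integral_cmult measurable_borel_prob_on[OF assms(2)]) measurable
  also have "(\<integral>\<^sup>+x. ennreal (exp (u \<bullet> x)) \<partial>\<mu>) = ennreal (\<integral>x. exp (u \<bullet> x) \<partial>\<mu>)"
    by (intro nn_integral_eq_integral integrable_exp_inner[OF assms]) simp
  also have "\<dots> = ennreal (exp (ln (\<integral>x. exp (u \<bullet> x) \<partial>\<mu>)))"
    using integral_exp_inner_pos[OF assms] by simp
  also have "exp_ext c * \<dots> = exp_ext (dual_mem_objective A b \<alpha> g \<mu> z)"
    by (simp add: dual_mem_objective_def c_def u_def exp_ext_add_ereal)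
  finally show ?thesis .
qed

lemma measurable_sample:
  assumes "\<And>i. i \<in> {1..n} \<Longrightarrow> X i \<in> S"
  shows "X \<in> measurable (uniform_count_measure {1..n}) (restrict_space borel S)"
  using assms by (auto simp: measurable_def space_restrict_space space_uniform_count_measure
      sets_uniform_count_measure)

text \<open>As the image of the uniform distribution on the index set under the sample, the empirical
  measure inherits its integral from the transformation formula.\<close>

lemma empirical_measure_eq_distr:
  assumes "\<And>i. i \<in> {1..n} \<Longrightarrow> X i \<in> S"
  shows "empirical_measure S n X =
    distr (uniform_count_measure {1..n}) (restrict_space borel S) X"
proof (rule measure_eqI)
  fix B assume "B \<in> sets (empirical_measure S n X)"
  then have B: "B \<in> sets (restrict_space borel S)" by simp
  have X: "X \<in> measurable (uniform_count_measure {1..n}) (restrict_space borel S)"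
    using assms(1) by (rule measurable_sample)
  have "(\<Sum>i=1..n. indicator B (X i) :: ennreal) = of_nat (card (X -` B \<inter> {1..n}))"
    by (simp add: indicator_def sum.If_cases Int_commute vimage_def)
  then show "emeasure (empirical_measure S n X) B =
      emeasure (distr (uniform_count_measure {1..n}) (restrict_space borel S) X) B"
    unfolding emeasure_empirical_measure[OF B] emeasure_distr[OF X B]
    by (simp add: space_uniform_count_measure emeasure_uniform_count_measure
        ennreal_of_nat_eq_real_of_nat flip: ennreal_mult')
qed simp

lemma nn_integral_empirical_measure:
  assumes "\<And>i. i \<in> {1..n} \<Longrightarrow> X i \<in> S" "f \<in> borel_measurable (restrict_space borel S)"
  shows "(\<integral>\<^sup>+x. f x \<partial>empirical_measure S n X) = ennreal (1 / real n) * (\<Sum>i=1..n. f (X i))"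
proof -
  have X: "X \<in> measurable (uniform_count_measure {1..n}) (restrict_space borel S)"
    using assms(1) by (rule measurable_sample)
  have distr: "empirical_measure S n X =
      distr (uniform_count_measure {1..n}) (restrict_space borel S) X"
    using assms(1) by (rule empirical_measure_eq_distr)
  have "(\<integral>\<^sup>+x. f x \<partial>empirical_measure S n X) = (\<integral>\<^sup>+i. f (X i) \<partial>uniform_count_measure {1..n})"
    unfolding distr by (rule nn_integral_distr[OF X]) (simp add: assms(2))
  also have "\<dots> = (\<Sum>i=1..n. ennreal (1 / real n) * f (X i))"
    by (simp add: uniform_count_measure_def nn_integral_point_measure_finite)
  finally show ?thesis by (simp add: sum_distrib_left)
qed

theorem mainTheorem2:
  fixes \<X> :: "(real^'m) set"
    and A :: "real^'m^'d"
    and b :: "real^'d"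
    and \<alpha> \<beta> :: real
    and g :: "real^'d \<Rightarrow> real"
    and grad_g :: "real^'d \<Rightarrow> real^'d"
  assumes "compact \<X>"
    and "\<alpha> > 0"
    and "\<beta> > 0"
    and "convex_on UNIV g"
    and "\<And>y. GDERIV g y :> grad_g y"
    and "(1 / \<beta>)-lipschitz_on UNIV grad_g"
  shows "(\<forall>\<mu>. borel_prob_on \<X> \<mu> \<longrightarrow>
            solutions (dual_mem_objective A b \<alpha> g \<mu>) =
            solutions (\<lambda>z. \<integral>\<^sup>+x. mem_loss A b \<alpha> g x z \<partial>\<mu>)) \<and>
         (\<forall>n X. n \<ge> 1 \<longrightarrow> (\<forall>i\<in>{1..n}. X i \<in> \<X>) \<longrightarrow>
            solutions (dual_mem_objective A b \<alpha> g (empirical_measure \<X> n X)) =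
            solutions (\<lambda>z. ennreal (1 / real n) * (\<Sum>i=1..n. mem_loss A b \<alpha> g (X i) z)))"
proof (intro conjI allI impI)
  have solutions_eq: "solutions (dual_mem_objective A b \<alpha> g \<mu>) =
      solutions (\<lambda>z. \<integral>\<^sup>+x. mem_loss A b \<alpha> g x z \<partial>\<mu>)" if "borel_prob_on \<X> \<mu>" for \<mu>
    using solutions_strict_mono[OF strict_mono_exp_ext, of "dual_mem_objective A b \<alpha> g \<mu>"]
    by (simp add: nn_integral_mem_loss[OF \<open>compact \<X>\<close> that])
  then show "solutions (dual_mem_objective A b \<alpha> g \<mu>) =
      solutions (\<lambda>z. \<integral>\<^sup>+x. mem_loss A b \<alpha> g x z \<partial>\<mu>)" if "borel_prob_on \<X> \<mu>" for \<mu>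
    using that .
  show "solutions (dual_mem_objective A b \<alpha> g (empirical_measure \<X> n X)) =
      solutions (\<lambda>z. ennreal (1 / real n) * (\<Sum>i=1..n. mem_loss A b \<alpha> g (X i) z))"
    if "n \<ge> 1" "\<forall>i\<in>{1..n}. X i \<in> \<X>" for n X
  proof -
    have "(\<lambda>x. mem_loss A b \<alpha> g x z) \<in> borel_measurable (restrict_space borel \<X>)" for z
      unfolding mem_loss_def exp_ext_add_ereal by (rule measurable_restrict_space1) measurable
    then have "(\<integral>\<^sup>+x. mem_loss A b \<alpha> g x z \<partial>empirical_measure \<X> n X) =
        ennreal (1 / real n) * (\<Sum>i=1..n. mem_loss A b \<alpha> g (X i) z)" for z
      using that(2) by (intro nn_integral_empirical_measure) auto
    moreover have "borel_prob_on \<X> (empirical_measure \<X> n X)"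
      using that by (intro borel_prob_on_empirical_measure) auto
    ultimately show ?thesis
      using solutions_eq[of "empirical_measure \<X> n X"] by simp
  qed
qed

end
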